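(* Let $\underline{G}$ be a connected reductive algebraic group over $\mathbb{R}$ and let $\mathbb{F}=\mathbb{C}$ or $\mathbb{F}=\mathbb{R}$. Let $G=\underline{G}(\mathbb{F})$, let $X=G/K$ be the corresponding symmetric space and $\mathfrak{p}$ the corresponding infinitesimal symmetric space. Then $$Sol(\mathbf{Q1},G)=D_3(\mathfrak{p}),\qquad Sol(\mathbf{Q2},G)=D_3(X).$$
   Context: $K\subset G$ is a maximal compact subgroup, $\mathfrak{g}=\mathfrak{k}\oplus\mathfrak{p}$ the Cartan decomposition of the Lie algebra of $G$, $\mathfrak{a}\subset\mathfrak{p}$ a Cartan subspace (maximal abelian), $W$ the finite (relative) Weyl group acting on $\mathfrak{a}$, $\Delta\subset\mathfrak{a}$ a closed Weyl chamber. One identifies $\mathfrak{p}/Ad(K)$ with $\Delta$, and $K\backslash G/K$ with $\Delta$ via $\sigma\mapsto K\exp(\sigma)K$. $Sol(\mathbf{Q1},G)\subset\Delta^3$: triples $(\alpha,\beta,\gamma)$ such that there exist $A,B,C\in\mathfrak{p}$ whose projections to $\mathfrak{p}/Ad(K)$ are $\alpha,\beta,\gamma$ and $A+B+C=0$. $Sol(\mathbf{Q2},G)\subset\Delta^3$: triples such that there exist $A,B,C\in G$ in the double cosets corresponding to $\alpha,\beta,\gamma$ with $ABC=1$. The apartments of $X$ are its maximal flats (the $G$-translates of $\exp(\mathfrak{a})\cdot o$, $o=K\in G/K$), identified with $\mathfrak{a}$ up to $W$ and translations; the apartments of $\mathfrak{p}$ are the affine translates of Cartan subspaces of $\mathfrak{p}$,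 identified with $\mathfrak{a}$ (by $Ad(K)$ and translations) up to $W$ and translations. Any two points lie in a common apartment. The $\Delta$-length of an oriented geodesic segment $\overline{xy}$ in $X$ or $\mathfrak{p}$ is obtained by regarding $\overline{xy}$ as a vector of $\mathfrak{a}$ in an apartment containing it and projecting this vector to $\mathfrak{a}/W=\Delta$. For $Y=X$ or $Y=\mathfrak{p}$, $D_3(Y)\subset\Delta^3$ is the set of triples of $\Delta$-lengths of the sides $\overline{x_1x_2},\overline{x_2x_3},\overline{x_3x_1}$ of geodesic triangles in $Y$. *)

theory Defs
  imports "HOL-Analysis.Analysis" "HOL-Algebra.Coset"
begin

section \<open>Linear algebraic groups\<close>

text \<open>
  An affine algebraic group over the reals is given by its group of complex points, embedded as a
  closed subgroup of some \<open>GL(n, \<complex>)\<close>; the size \<open>n\<close> is the cardinality of the index type \<open>'n\<close>.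
\<close>

definition GL :: "(complex^'n^'n) monoid" where
  "GL = \<lparr>carrier = {A. invertible A}, mult = (**), one = mat 1\<rparr>"

abbreviation as_group :: "(complex^'n^'n) set \<Rightarrow> (complex^'n^'n) monoid" where
  "as_group G \<equiv> GL\<lparr>carrier := G\<rparr>"

primrec mat_power :: "complex^'n^'n \<Rightarrow> nat \<Rightarrow> complex^'n^'n" where
  "mat_power A 0 = mat 1"
| "mat_power A (Suc k) = A ** mat_power A k"

inductive_set poly_fun :: "complex set \<Rightarrow> (complex^'n^'n \<Rightarrow> complex) set" for F where
  const: "c \<in> F \<Longrightarrow> (\<lambda>A. c) \<in> poly_fun F"
| entry: "(\<lambda>A. A $ i $ j) \<in> poly_fun F"
| add: "p \<in> poly_fun F \<Longrightarrow> q \<in> poly_fun F \<Longrightarrow> (\<lambda>A. p A + q A) \<in> poly_fun F"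
| mult: "p \<in> poly_fun F \<Longrightarrow> q \<in> poly_fun F \<Longrightarrow> (\<lambda>A. p A * q A) \<in> poly_fun F"

text \<open>
  The Zariski \<open>F\<close>-topology on \<open>GL(n, \<complex>)\<close>: the closed sets are the sets of complex zeros of
  polynomials with coefficients in \<open>F\<close> (see \<open>closedin_zariski\<close> below).
\<close>

definition zariski :: "complex set \<Rightarrow> (complex^'n^'n) topology" where
  "zariski F = topology (\<lambda>U. \<exists>P \<subseteq> poly_fun F. U = {A \<in> carrier GL. \<exists>p\<in>P. p A \<noteq> 0})"

lemma openin_zariski:
  "openin (zariski F) U \<longleftrightarrow> (\<exists>P \<subseteq> poly_fun F. U = {A \<in> carrier GL. \<exists>p\<in>P. p A \<noteq> 0})"
proof -
  let ?L = "\<lambda>U :: (complex^'n^'n) set.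
    \<exists>P \<subseteq> poly_fun F. U = {A \<in> carrier GL. \<exists>p\<in>P. p A \<noteq> 0}"
  have "istopology ?L"
    unfolding istopology_def
  proof (intro conjI allI impI)
    fix S T :: "(complex^'n^'n) set"
    assume "?L S" "?L T"
    then obtain P Q where P: "P \<subseteq> poly_fun F" "S = {A \<in> carrier GL. \<exists>p\<in>P. p A \<noteq> 0}"
      and Q: "Q \<subseteq> poly_fun F" "T = {A \<in> carrier GL. \<exists>p\<in>Q. p A \<noteq> 0}"
      by blast
    let ?R = "(\<lambda>(p, q). \<lambda>A. p A * q A) ` (P \<times> Q)"
    have "?R \<subseteq> poly_fun F"
      using P(1) Q(1) by (auto intro!: poly_fun.mult)
    moreover have "S \<inter> T = {A \<in> carrier GL. \<exists>p\<in>?R. p A \<noteq> 0}"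
      unfolding P(2) Q(2) by auto
    ultimately show "?L (S \<inter> T)"
      by blast
  next
    fix \<K> :: "(complex^'n^'n) set set"
    assume *: "\<forall>S\<in>\<K>. ?L S"
    let ?P = "{p \<in> poly_fun F. {A \<in> carrier GL. p A \<noteq> 0} \<subseteq> \<Union>\<K>}"
    have "\<Union>\<K> = {A \<in> carrier GL. \<exists>p\<in>?P. p A \<noteq> 0}"
    proof (intro equalityI subsetI)
      fix A assume "A \<in> \<Union>\<K>"
      then obtain S where S: "S \<in> \<K>" "A \<in> S" by blast
      then obtain P where P: "P \<subseteq> poly_fun F" "S = {A \<in> carrier GL. \<exists>p\<in>P. p A \<noteq> 0}"
        using * by meson
      then obtain p where p: "p \<in> P" "p A \<noteq> 0" "A \<in> carrier GL"
        using S(2) by blast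
      have "{A \<in> carrier GL. p A \<noteq> 0} \<subseteq> \<Union>\<K>"
        using P(2) p(1) S(1) by blast
      then show "A \<in> {A \<in> carrier GL. \<exists>p\<in>?P. p A \<noteq> 0}"
        using p P(1) by blast
    qed blast
    then show "?L (\<Union>\<K>)"
      by (intro exI[of _ ?P] conjI) auto
  qed
  then have "openin (topology ?L) = ?L"
    by (rule topology_inverse')
  from fun_cong[OF this, of U] show ?thesis
    unfolding zariski_def .
qed

lemma topspace_zariski: "topspace (zariski F) = (carrier GL :: (complex^'n^'n) set)"
proof -
  have nz: "\<exists>i j. A $ i $ j \<noteq> 0" if "invertible A" for A :: "complex^'n^'n"
  proof (rule ccontr)
    assume "\<not> ?thesis"
    then have "A = 0" by (simp add: vec_eq_iff)
    moreover obtain B where "A ** B = mat 1"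
      using \<open>invertible A\<close> unfolding invertible_def by blast
    ultimately have "(0 :: complex^'n^'n) = mat 1"
      by (simp add: matrix_matrix_mult_def vec_eq_iff)
    then have "(0 :: complex^'n^'n) $ i $ i = mat 1 $ i $ i" for i
      by simp
    then show False
      by (simp add: mat_def)
  qed
  let ?P = "(\<lambda>(i, j). \<lambda>A :: complex^'n^'n. A $ i $ j) ` UNIV"
  have "?P \<subseteq> poly_fun F"
    by (auto intro: poly_fun.entry)
  moreover have "carrier GL = {A \<in> carrier GL. \<exists>p\<in>?P. p A \<noteq> 0}"
    using nz by (auto simp: GL_def)
  ultimately have "openin (zariski F) (carrier GL :: (complex^'n^'n) set)"
    unfolding openin_zariski by blast
  then show ?thesis
    by (auto simp: topspace_def openin_zariski)
qed

lemma closedin_zariski: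
  "closedin (zariski F) S \<longleftrightarrow> (\<exists>P \<subseteq> poly_fun F. S = {A \<in> carrier GL. \<forall>p\<in>P. p A = 0})"
proof
  assume "closedin (zariski F) S"
  then obtain P where P: "S \<subseteq> carrier GL" "P \<subseteq> poly_fun F"
      "carrier GL - S = {A \<in> carrier GL. \<exists>p\<in>P. p A \<noteq> 0}"
    by (auto simp: closedin_def topspace_zariski openin_zariski)
  then have "S = {A \<in> carrier GL. \<forall>p\<in>P. p A = 0}"
    by blast
  with P(2) show "\<exists>P \<subseteq> poly_fun F. S = {A \<in> carrier GL. \<forall>p\<in>P. p A = 0}"
    by blast
next
  assume "\<exists>P \<subseteq> poly_fun F. S = {A \<in> carrier GL. \<forall>p\<in>P. p A = 0}"
  then obtain P where P: "P \<subseteq> poly_fun F" "S = {A \<in> carrier GL. \<forall>p\<in>P. p A = 0}"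
    by blast
  then have "carrier GL - S = {A \<in> carrier GL. \<exists>p\<in>P. p A \<noteq> 0}"
    by blast
  with P show "closedin (zariski F) S"
    by (auto simp: closedin_def topspace_zariski openin_zariski)
qed

definition unipotent :: "complex^'n^'n \<Rightarrow> bool" where
  "unipotent A \<longleftrightarrow> (\<exists>m. mat_power (A - mat 1) m = 0)"

text \<open>
  Reductive means that the unipotent radical, the largest connected normal unipotent closed
  subgroup of the group of complex points, is trivial.
\<close>

definition connected_reductive_group :: "(complex^'n^'n) set \<Rightarrow> bool" where
  "connected_reductive_group G \<longleftrightarrow>
     subgroup G GL \<and> closedin (zariski \<real>) G \<and> connectedin (zariski UNIV) G \<and>
     (\<forall>U. U \<lhd> as_group G \<and> closedin (zariski UNIV) U \<and> connectedin (zariski UNIV) U \<and>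
          (\<forall>A\<in>U. unipotent A) \<longrightarrow> U = {mat 1})"

definition rational_points :: "complex set \<Rightarrow> (complex^'n^'n) set \<Rightarrow> (complex^'n^'n) set" where
  "rational_points F G = {A \<in> G. \<forall>i j. A $ i $ j \<in> F}"


section \<open>Lie algebra and Cartan decomposition\<close>

text \<open>Groups of complex points are regarded as real Lie groups.\<close>

definition mexp :: "complex^'n^'n \<Rightarrow> complex^'n^'n" where
  "mexp X = (\<Sum>k. (1 / fact k) *\<^sub>R mat_power X k)"

definition Ad :: "complex^'n^'n \<Rightarrow> complex^'n^'n \<Rightarrow> complex^'n^'n" where
  "Ad g X = g ** X ** matrix_inv g"

definition bracket :: "complex^'n^'n \<Rightarrow> complex^'n^'n \<Rightarrow> complex^'n^'n" where
  "bracket X Y = X ** Y - Y ** X"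

definition lie_algebra :: "(complex^'n^'n) set \<Rightarrow> (complex^'n^'n) set" where
  "lie_algebra G = {X. \<forall>t::real. mexp (t *\<^sub>R X) \<in> G}"

definition maximal_compact_subgroup ::
    "(complex^'n^'n) set \<Rightarrow> (complex^'n^'n) set \<Rightarrow> bool" where
  "maximal_compact_subgroup K G \<longleftrightarrow>
     subgroup K (as_group G) \<and> compact K \<and>
     (\<forall>K'. subgroup K' (as_group G) \<and> compact K' \<and> K \<subseteq> K' \<longrightarrow> K' = K)"

definition trace_form :: "complex^'n^'n \<Rightarrow> complex^'n^'n \<Rightarrow> real" where
  "trace_form X Y = Re (trace (X ** Y))"

text \<open>
  The invariant form used is the real part of the trace form rather than the Killing form, which
  vanishes on the centre. With it, \<open>p\<close> is the orthogonal complement of \<open>k\<close> in \<open>g\<close>, also on the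
  centre. By Mostow's theorem, after conjugating \<open>G\<close> to a self-adjoint group in which \<open>K\<close> consists
  of the unitary elements, \<open>k\<close> and \<open>p\<close> are the skew-Hermitian and the Hermitian part of \<open>g\<close>.
\<close>

definition cartan_decomposition ::
    "(complex^'n^'n) set \<Rightarrow> (complex^'n^'n) set \<Rightarrow> (complex^'n^'n) set \<Rightarrow> bool" where
  "cartan_decomposition g k p \<longleftrightarrow>
     subspace k \<and> subspace p \<and> g = {X + Y | X Y. X \<in> k \<and> Y \<in> p} \<and> k \<inter> p = {0} \<and>
     (\<forall>X\<in>k. \<forall>Y\<in>k. bracket X Y \<in> k) \<and>
     (\<forall>X\<in>k. \<forall>Y\<in>p. bracket X Y \<in> p) \<and>
     (\<forall>X\<in>p. \<forall>Y\<in>p. bracket X Y \<in> k) \<and>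
     (\<forall>X\<in>k. \<forall>Y\<in>p. trace_form X Y = 0) \<and>
     (\<forall>X\<in>k. X \<noteq> 0 \<longrightarrow> trace_form X X < 0) \<and>
     (\<forall>Y\<in>p. Y \<noteq> 0 \<longrightarrow> trace_form Y Y > 0)"

definition abelian_subspace :: "(complex^'n^'n) set \<Rightarrow> (complex^'n^'n) set \<Rightarrow> bool" where
  "abelian_subspace p a \<longleftrightarrow> subspace a \<and> a \<subseteq> p \<and> (\<forall>X\<in>a. \<forall>Y\<in>a. bracket X Y = 0)"

definition cartan_subspace :: "(complex^'n^'n) set \<Rightarrow> (complex^'n^'n) set \<Rightarrow> bool" where
  "cartan_subspace p a \<longleftrightarrow>
     abelian_subspace p a \<and> (\<forall>b. abelian_subspace p b \<and> a \<subseteq> b \<longrightarrow> b = a)"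


section \<open>Weyl group and Weyl chambers\<close>

text \<open>
  \<open>weyl_group K a\<close> is the normalizer of \<open>a\<close> in \<open>K\<close> modulo its centralizer, realized as a group of
  transformations of \<open>a\<close>.
\<close>

definition weyl_group ::
    "(complex^'n^'n) set \<Rightarrow> (complex^'n^'n) set \<Rightarrow> (complex^'n^'n \<Rightarrow> complex^'n^'n) set" where
  "weyl_group K a = {restrict (Ad k) a | k. k \<in> K \<and> Ad k ` a = a}"

text \<open>Linearity of a restricted root on \<open>a\<close> follows from the eigenvector equation.\<close>

definition restricted_roots ::
    "(complex^'n^'n) set \<Rightarrow> (complex^'n^'n) set \<Rightarrow> (complex^'n^'n \<Rightarrow> real) set" where
  "restricted_roots g a =
     {\<rho> \<in> extensional a. (\<exists>H\<in>a. \<rho> H \<noteq> 0) \<and>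
        (\<exists>X\<in>g. X \<noteq> 0 \<and> (\<forall>H\<in>a. bracket H X = \<rho> H *\<^sub>R X))}"

definition closed_weyl_chamber ::
    "(complex^'n^'n) set \<Rightarrow> (complex^'n^'n) set \<Rightarrow> (complex^'n^'n) set \<Rightarrow> bool" where
  "closed_weyl_chamber g a \<Delta> \<longleftrightarrow>
     (\<exists>C \<in> components {H \<in> a. \<forall>\<rho> \<in> restricted_roots g a. \<rho> H \<noteq> 0}. \<Delta> = closure C)"


section \<open>The solution sets of the two algebra problems\<close>

text \<open>An element of \<open>p / Ad(K)\<close> is an orbit; \<open>\<alpha> \<in> \<Delta>\<close> stands for the orbit of \<open>\<alpha>\<close>.\<close>

definition Ad_orbit :: "(complex^'n^'n) set \<Rightarrow> complex^'n^'n \<Rightarrow> (complex^'n^'n) set" where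
  "Ad_orbit K A = (\<lambda>k. Ad k A) ` K"

definition Sol_Q1 :: "(complex^'n^'n) set \<Rightarrow> (complex^'n^'n) set \<Rightarrow> (complex^'n^'n) set \<Rightarrow>
    ((complex^'n^'n) \<times> (complex^'n^'n) \<times> (complex^'n^'n)) set" where
  "Sol_Q1 K p \<Delta> = {(\<alpha>, \<beta>, \<gamma>). \<alpha> \<in> \<Delta> \<and> \<beta> \<in> \<Delta> \<and> \<gamma> \<in> \<Delta> \<and>
     (\<exists>A\<in>p. \<exists>B\<in>p. \<exists>C\<in>p.
        Ad_orbit K A = Ad_orbit K \<alpha> \<and> Ad_orbit K B = Ad_orbit K \<beta> \<and>
        Ad_orbit K C = Ad_orbit K \<gamma> \<and> A + B + C = 0)}"

definition double_coset :: "(complex^'n^'n) set \<Rightarrow> complex^'n^'n \<Rightarrow> (complex^'n^'n) set" where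
  "double_coset K \<sigma> = (K #>\<^bsub>GL\<^esub> mexp \<sigma>) <#>\<^bsub>GL\<^esub> K"

definition Sol_Q2 :: "(complex^'n^'n) set \<Rightarrow> (complex^'n^'n) set \<Rightarrow> (complex^'n^'n) set \<Rightarrow>
    ((complex^'n^'n) \<times> (complex^'n^'n) \<times> (complex^'n^'n)) set" where
  "Sol_Q2 G K \<Delta> = {(\<alpha>, \<beta>, \<gamma>). \<alpha> \<in> \<Delta> \<and> \<beta> \<in> \<Delta> \<and> \<gamma> \<in> \<Delta> \<and>
     (\<exists>A\<in>G. \<exists>B\<in>G. \<exists>C\<in>G.
        A \<in> double_coset K \<alpha> \<and> B \<in> double_coset K \<beta> \<and> C \<in> double_coset K \<gamma> \<and>
        A ** B ** C = mat 1)}"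


section \<open>Apartments, \<open>\<Delta>\<close>-lengths and triangles\<close>

text \<open>Points of \<open>X = G/K\<close> are left cosets; the base point is the coset \<open>K\<close>.\<close>

definition symmetric_space ::
    "(complex^'n^'n) set \<Rightarrow> (complex^'n^'n) set \<Rightarrow> (complex^'n^'n) set set" where
  "symmetric_space G K = (\<lambda>g. g <#\<^bsub>GL\<^esub> K) ` G"

definition apartments_X :: "(complex^'n^'n) set \<Rightarrow> (complex^'n^'n) set \<Rightarrow> (complex^'n^'n) set \<Rightarrow>
    (complex^'n^'n) set set set" where
  "apartments_X G K a = {(\<lambda>u. g <#\<^bsub>GL\<^esub> (mexp u <#\<^bsub>GL\<^esub> K)) ` a | g. g \<in> G}"

definition charts_X :: "(complex^'n^'n) set \<Rightarrow> (complex^'n^'n) set \<Rightarrow> (complex^'n^'n) set \<Rightarrow>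
    (complex^'n^'n) set set \<Rightarrow> (complex^'n^'n \<Rightarrow> (complex^'n^'n) set) set" where
  "charts_X G K a E =
     {\<phi>. \<exists>g\<in>G. \<phi> = (\<lambda>u\<in>a. g <#\<^bsub>GL\<^esub> (mexp u <#\<^bsub>GL\<^esub> K)) \<and> \<phi> ` a = E}"

definition apartments_p :: "(complex^'n^'n) set \<Rightarrow> (complex^'n^'n) set set" where
  "apartments_p p = {(\<lambda>v. x + v) ` b | x b. x \<in> p \<and> cartan_subspace p b}"

definition charts_p :: "(complex^'n^'n) set \<Rightarrow> (complex^'n^'n) set \<Rightarrow> (complex^'n^'n) set \<Rightarrow>
    (complex^'n^'n) set \<Rightarrow> (complex^'n^'n \<Rightarrow> complex^'n^'n) set" where
  "charts_p K p a E = {\<phi>. \<exists>x\<in>p. \<exists>k\<in>K. \<phi> = (\<lambda>u\<in>a. x + Ad k u) \<and> \<phi> ` a = E}"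

text \<open>
  \<open>\<alpha> \<in> delta_lengths W a \<Delta> apts charts x y\<close> says that \<open>\<alpha> \<in> \<Delta>\<close> is the \<open>\<Delta>\<close>-length of the
  geodesic segment from \<open>x\<close> to \<open>y\<close>: in some apartment containing the end points (hence the
  segment), the vector from \<open>x\<close> to \<open>y\<close>, read in \<open>a\<close>, represents the same element of \<open>a / W\<close> as \<open>\<alpha>\<close>.
  That such an \<open>\<alpha>\<close> exists and is unique is a fact about symmetric spaces which the definition does
  not presuppose.
\<close>

definition delta_lengths ::
    "(complex^'n^'n \<Rightarrow> complex^'n^'n) set \<Rightarrow> (complex^'n^'n) set \<Rightarrow> (complex^'n^'n) set \<Rightarrow>
     'x set set \<Rightarrow> ('x set \<Rightarrow> (complex^'n^'n \<Rightarrow> 'x) set) \<Rightarrow> 'x \<Rightarrow> 'x \<Rightarrow> (complex^'n^'n) set" where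
  "delta_lengths W a \<Delta> apts charts x y = {\<alpha> \<in> \<Delta>.
     \<exists>E\<in>apts. x \<in> E \<and> y \<in> E \<and>
       (\<exists>\<phi>\<in>charts E. \<exists>u\<in>a. \<exists>v\<in>a. \<phi> u = x \<and> \<phi> v = y \<and>
          (\<lambda>w. w (v - u)) ` W = (\<lambda>w. w \<alpha>) ` W)}"

text \<open>
  Geodesic segments in \<open>X\<close> and in \<open>p\<close> are determined by their end points, so a (possibly
  degenerate) geodesic triangle is given by its vertices.
\<close>

definition D3 :: "'x set \<Rightarrow> ('x \<Rightarrow> 'x \<Rightarrow> 'v set) \<Rightarrow> ('v \<times> 'v \<times> 'v) set" where
  "D3 Y len = {(\<alpha>, \<beta>, \<gamma>). \<exists>x1\<in>Y. \<exists>x2\<in>Y. \<exists>x3\<in>Y.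
     \<alpha> \<in> len x1 x2 \<and> \<beta> \<in> len x2 x3 \<and> \<gamma> \<in> len x3 x1}"

definition D3_p :: "(complex^'n^'n) set \<Rightarrow> (complex^'n^'n) set \<Rightarrow> (complex^'n^'n) set \<Rightarrow>
    (complex^'n^'n) set \<Rightarrow> ((complex^'n^'n) \<times> (complex^'n^'n) \<times> (complex^'n^'n)) set" where
  "D3_p K p a \<Delta> =
     D3 p (delta_lengths (weyl_group K a) a \<Delta> (apartments_p p) (charts_p K p a))"

definition D3_X :: "(complex^'n^'n) set \<Rightarrow> (complex^'n^'n) set \<Rightarrow> (complex^'n^'n) set \<Rightarrow>
    (complex^'n^'n) set \<Rightarrow> ((complex^'n^'n) \<times> (complex^'n^'n) \<times> (complex^'n^'n)) set" where
  "D3_X G K a \<Delta> =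
     D3 (symmetric_space G K)
       (delta_lengths (weyl_group K a) a \<Delta> (apartments_X G K a) (charts_X G K a))"

end

theory Submission
  imports Defs
begin

text \<open>
  Both equalities express that a triangle is determined, up to the choice of its first vertex, by
  three consecutive differences of its vertices: vectors with sum zero in \<open>p\<close>, group elements with
  product \<open>1\<close> in \<open>X = G/K\<close>. What has to be shown is that \<open>\<Delta>\<close>-length, which is defined
  through apartments, charts and the Weyl group, is the class of such a difference modulo \<open>K\<close>.

  In \<open>p\<close>, a segment from \<open>x\<close> to \<open>y\<close> has \<open>\<Delta>\<close>-length \<open>\<alpha>\<close> if and only if \<open>\<alpha> \<in> \<Delta>\<close> and \<open>y - x\<close>
  lies in the \<open>Ad K\<close>-orbit of \<open>\<alpha>\<close> (\<open>delta_lengths_p_iff\<close>). The charts and the Weyl group act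
  through \<open>Ad K\<close>, which gives one direction. For the other, a translate of \<open>Ad k a\<close> serves as the
  apartment; that \<open>Ad k a\<close> is again a Cartan subspace rests on the invariance of \<open>p\<close> under
  \<open>Ad K\<close>, which holds because \<open>p\<close> is an orthogonal complement for an invariant form
  (\<open>Ad_cartan_decomposition\<close>).

  In \<open>X\<close>, a segment has \<open>\<Delta>\<close>-length \<open>\<alpha>\<close> if and only if \<open>\<alpha> \<in> \<Delta>\<close> and the segment is a translate of the
  one from \<open>K\<close> to \<open>exp(\<alpha>) K\<close> (\<open>delta_lengths_X_iff\<close>). To compare two points of one flat one needs
  \<open>exp(u + v) = exp(u) exp(v)\<close> for commuting \<open>u\<close> and \<open>v\<close>, and \<open>exp(Ad k u) = Ad k (exp u)\<close> to move
  the vector between them into the chamber; these are \<open>mexp_add_commuting\<close> and \<open>mexp_Ad\<close>. The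
  segments from \<open>g K\<close> to \<open>g A K\<close> of \<open>\<Delta>\<close>-length \<open>\<alpha>\<close> are then those with \<open>A\<close> in the double coset of
  \<open>exp(\<alpha>)\<close> (\<open>double_coset_iff\<close>).
\<close>

section \<open>The exponential of commuting matrices\<close>

text \<open>
  Matrix multiplication does not make \<open>complex^'n^'n\<close> an instance of \<open>real_normed_algebra\<close>, so the
  Cauchy product is proved here for an arbitrary bounded bilinear map. The products
  \<open>h (a i) (b j)\<close> form an absolutely summable family on \<open>\<nat> \<times> \<nat>\<close>: summing it by rows gives
  \<open>h (suminf a) (suminf b)\<close>, summing it along the antidiagonals \<open>i + j = k\<close> gives the claim.
\<close>

lemma bounded_bilinear_Cauchy_product_sums:
  fixes a :: "nat \<Rightarrow> 'a::banach" and b :: "nat \<Rightarrow> 'b::banach" and h :: "'a \<Rightarrow> 'b \<Rightarrow> 'c::banach"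
  assumes h: "bounded_bilinear h"
    and a: "summable (\<lambda>k. norm (a k))" and b: "summable (\<lambda>k. norm (b k))"
  shows "(\<lambda>k. \<Sum>i\<le>k. h (a i) (b (k - i))) sums h (suminf a) (suminf b)"
proof -
  interpret bounded_bilinear h by (fact h)
  obtain M where M: "norm (h x y) \<le> norm x * norm y * M" for x y
    using bounded by blast
  let ?P = "\<lambda>(i, j). h (a i) (b j)"
  have a': "(\<lambda>k. norm (a k)) summable_on UNIV" and b': "(\<lambda>k. norm (b k)) summable_on UNIV"
    using a b by (simp_all add: norm_summable_imp_summable_on)
  let ?N = "\<lambda>i j. norm (a i) * norm (b j) * M"
  have "(\<lambda>x. norm ((\<lambda>(i, j). ?N i j) x)) summable_on (UNIV \<times> UNIV)"
    unfolding Infinite_Sum.abs_summable_on_Sigma_iff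
  proof (intro conjI ballI)
    show "(\<lambda>j. norm (case (i, j) of (i, j) \<Rightarrow> ?N i j)) summable_on UNIV" for i
      using summable_on_cmult_right[OF b', of "norm (a i) * \<bar>M\<bar>"]
      by (simp add: abs_mult mult_ac)
    have "(\<Sum>\<^sub>\<infinity>j. norm (case (i, j) of (i, j) \<Rightarrow> ?N i j)) =
        norm (a i) * (\<bar>M\<bar> * (\<Sum>\<^sub>\<infinity>j. norm (b j)))" for i
      by (simp add: abs_mult infsum_cmult_right' infsum_cmult_left' mult_ac)
    then show "(\<lambda>i. norm (\<Sum>\<^sub>\<infinity>j. norm (case (i, j) of (i, j) \<Rightarrow> ?N i j))) summable_on UNIV"
      using summable_on_cmult_left[OF a', of "\<bar>\<bar>M\<bar> * (\<Sum>\<^sub>\<infinity>j. norm (b j))\<bar>"]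
      by (simp add: abs_mult mult_ac)
  qed
  then have "(\<lambda>x. norm (?P x)) summable_on (UNIV \<times> UNIV)"
    by (rule Infinite_Sum.abs_summable_on_comparison_test) (auto intro: order_trans[OF M])
  then have P: "?P summable_on (UNIV \<times> UNIV)"
    by (rule abs_summable_summable)
  have sa: "(a has_sum suminf a) UNIV" and sb: "(b has_sum suminf b) UNIV"
    using a b by (auto intro!: norm_summable_imp_has_sum summable_sums summable_norm_cancel)
  have "infsum ?P (UNIV \<times> UNIV) = (\<Sum>\<^sub>\<infinity>i. \<Sum>\<^sub>\<infinity>j. h (a i) (b j))"
    using infsum_Sigma_banach[OF P] by simp
  also have "\<dots> = (\<Sum>\<^sub>\<infinity>i. h (a i) (suminf b))"
    using has_sum_bounded_linear[OF bounded_linear_right sb]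
    by (intro infsum_cong infsumI) (auto simp: o_def)
  also have "\<dots> = h (suminf a) (suminf b)"
    using has_sum_bounded_linear[OF bounded_linear_left sa] by (intro infsumI) (auto simp: o_def)
  finally have "(?P has_sum h (suminf a) (suminf b)) (UNIV \<times> UNIV)"
    using P by (metis has_sum_infsum)
  then have "((\<lambda>(k, i). h (a i) (b (k - i))) has_sum h (suminf a) (suminf b))
      (Sigma UNIV (\<lambda>k. {..k}))"
    by (subst has_sum_reindex_bij_witness[where T = "UNIV \<times> UNIV" and h = ?P
        and j = "\<lambda>(k, i). (i, k - i)" and i = "\<lambda>(i, j). (i + j, i)"]) auto
  then have "((\<lambda>k. \<Sum>i\<le>k. h (a i) (b (k - i))) has_sum h (suminf a) (suminf b)) UNIV"
    by (rule has_sum_SigmaD) (auto intro: has_sum_finite)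
  then show ?thesis
    by (rule has_sum_imp_sums)
qed

lemma bounded_bilinear_matrix_matrix_mult:
  "bounded_bilinear ((**) :: complex^'n^'n \<Rightarrow> complex^'n^'n \<Rightarrow> complex^'n^'n)"
proof -
  have "bilinear ((**) :: complex^'n^'n \<Rightarrow> complex^'n^'n \<Rightarrow> complex^'n^'n)"
    unfolding bilinear_def
    by (auto intro!: linearI simp: matrix_matrix_mult_def vec_eq_iff
        distrib_left distrib_right sum.distrib scaleR_right.sum scaleR_sum_right)
  then show ?thesis
    by (simp add: bilinear_conv_bounded_bilinear)
qed

global_interpretation matrix_mult:
  bounded_bilinear "(**) :: complex^'n^'n \<Rightarrow> complex^'n^'n \<Rightarrow> complex^'n^'n"
  by (rule bounded_bilinear_matrix_matrix_mult)

lemma mat_power_commute: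
  assumes "X ** Y = Y ** X"
  shows "mat_power X k ** Y = Y ** mat_power X k"
proof (induction k)
  case (Suc k)
  then show ?case
    by (metis assms mat_power.simps(2) matrix_mul_assoc)
qed simp

lemma summable_norm_mexp_series:
  fixes X :: "complex^'n^'n"
  shows "summable (\<lambda>k. norm ((1 / fact k) *\<^sub>R mat_power X k))"
proof -
  obtain M where M: "M \<ge> 0" "norm (A ** B) \<le> norm A * norm B * M" for A B :: "complex^'n^'n"
    using matrix_mult.nonneg_bounded by blast
  \<comment> \<open>The norm on matrices is submultiplicative only up to the factor \<open>M\<close>, and \<open>mat 1\<close> need not have
    norm \<open>1\<close>.\<close>
  have bound: "norm (mat_power X k) \<le> norm (mat 1 :: complex^'n^'n) * (norm X * M) ^ k" for k
  proof (induction k)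
    case (Suc k)
    have "norm (mat_power X (Suc k)) \<le> norm X * M * norm (mat_power X k)"
      using M(2)[of X "mat_power X k"] by (simp add: mult_ac)
    also have "\<dots> \<le> norm X * M * (norm (mat 1 :: complex^'n^'n) * (norm X * M) ^ k)"
      using Suc M(1) by (intro mult_left_mono) auto
    finally show ?case by (simp add: mult_ac)
  qed simp
  have "summable (\<lambda>k. norm (mat 1 :: complex^'n^'n) * ((norm X * M) ^ k /\<^sub>R fact k))"
    by (intro summable_mult summable_exp_generic)
  moreover have "norm (norm ((1 / fact k) *\<^sub>R mat_power X k))
      \<le> norm (mat 1 :: complex^'n^'n) * ((norm X * M) ^ k /\<^sub>R fact k)" for k
    using bound[of k] by (simp add: divide_simps)
  ultimately show ?thesis
    by (rule summable_comparison_test'[of _ 0])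
qed

text \<open>
  The binomial formula, in the normalization in which the \<open>k\<close>-th term is \<open>X\<^sup>k / k!\<close>. In the
  induction step \<open>X\<close> raises the first index and \<open>Y\<close> the second, and the resulting weights \<open>i\<close> and
  \<open>Suc n - i\<close> add up to \<open>Suc n\<close>.
\<close>

lemma mexp_series_add:
  fixes X Y :: "complex^'n^'n"
  assumes comm: "X ** Y = Y ** X"
  defines "S \<equiv> \<lambda>X k. (1 / fact k) *\<^sub>R mat_power X k :: complex^'n^'n"
  shows "S (X + Y) k = (\<Sum>i\<le>k. S X i ** S Y (k - i))"
proof (induction k)
  case 0
  then show ?case by (simp add: S_def)
next
  case (Suc n)
  have times_S: "X ** S X n = real (Suc n) *\<^sub>R S X (Suc n)" for X n
    by (simp add: S_def matrix_mult.scaleR_right del: of_nat_Suc)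
  have S_comm: "Y ** S X i = S X i ** Y" for i
    by (simp add: S_def matrix_mult.scaleR_right matrix_mult.scaleR_left mat_power_commute[OF comm])
  have "real (Suc n) *\<^sub>R S (X + Y) (Suc n) = (X + Y) ** (\<Sum>i\<le>n. S X i ** S Y (n - i))"
    by (metis Suc.IH times_S)
  also have "\<dots> = (\<Sum>i\<le>n. X ** S X i ** S Y (n - i)) + (\<Sum>i\<le>n. S X i ** (Y ** S Y (n - i)))"
    by (simp add: matrix_mult.add_left matrix_mult.sum_right matrix_mul_assoc S_comm sum.distrib)
  also have "\<dots> = (\<Sum>i\<le>n. real (Suc i) *\<^sub>R (S X (Suc i) ** S Y (n - i)))
                + (\<Sum>i\<le>n. real (Suc n - i) *\<^sub>R (S X i ** S Y (Suc n - i)))"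
    by (simp add: times_S Suc_diff_le matrix_mult.scaleR_right matrix_mult.scaleR_left)
  also have "(\<Sum>i\<le>n. real (Suc i) *\<^sub>R (S X (Suc i) ** S Y (n - i)))
           = (\<Sum>i\<le>Suc n. real i *\<^sub>R (S X i ** S Y (Suc n - i)))"
    by (subst sum.atMost_Suc_shift) simp
  also have "(\<Sum>i\<le>n. real (Suc n - i) *\<^sub>R (S X i ** S Y (Suc n - i)))
           = (\<Sum>i\<le>Suc n. real (Suc n - i) *\<^sub>R (S X i ** S Y (Suc n - i)))"
    by simp
  also have "(\<Sum>i\<le>Suc n. real i *\<^sub>R (S X i ** S Y (Suc n - i)))
           + (\<Sum>i\<le>Suc n. real (Suc n - i) *\<^sub>R (S X i ** S Y (Suc n - i)))
           = (\<Sum>i\<le>Suc n. real (Suc n) *\<^sub>R (S X i ** S Y (Suc n - i)))"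
    by (simp flip: sum.distrib scaleR_add_left of_nat_add)
  also have "\<dots> = real (Suc n) *\<^sub>R (\<Sum>i\<le>Suc n. S X i ** S Y (Suc n - i))"
    by (simp only: scaleR_right.sum)
  finally show ?case
    by (simp del: sum.cl_ivl_Suc of_nat_Suc)
qed

lemma mexp_add_commuting:
  assumes "X ** Y = Y ** X"
  shows "mexp (X + Y) = mexp X ** mexp Y"
  using bounded_bilinear_Cauchy_product_sums[OF bounded_bilinear_matrix_matrix_mult
      summable_norm_mexp_series[of X] summable_norm_mexp_series[of Y]]
  unfolding mexp_def mexp_series_add[OF assms, symmetric] by (simp add: sums_iff)

section \<open>Subgroups of the general linear group\<close>

lemma matrix_inv:
  fixes A :: "complex^'n^'n"
  assumes "invertible A"
  shows "A ** matrix_inv A = mat 1" "matrix_inv A ** A = mat 1"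
proof -
  have "A ** matrix_inv A = mat 1 \<and> matrix_inv A ** A = mat 1"
    using assms unfolding invertible_def matrix_inv_def by (rule someI_ex)
  then show "A ** matrix_inv A = mat 1" "matrix_inv A ** A = mat 1" by auto
qed

lemma invertible_matrix_inv: "invertible A \<Longrightarrow> invertible (matrix_inv (A :: complex^'n^'n))"
  using matrix_inv[of A] unfolding invertible_def by blast

lemma matrix_inv_unique:
  fixes A :: "complex^'n^'n"
  assumes "A ** B = mat 1"
  shows "matrix_inv A = B"
  by (metis assms invertible_def matrix_inv(2) matrix_left_right_inverse matrix_mul_assoc
      matrix_mul_lid matrix_mul_rid)

lemma group_GL: "group (GL :: (complex^'n^'n) monoid)"
proof (rule groupI)
  show "\<exists>B\<in>carrier GL. B \<otimes>\<^bsub>GL\<^esub> A = \<one>\<^bsub>GL\<^esub>" if "A \<in> carrier GL" for A :: "complex^'n^'n"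
    using that matrix_inv[of A] invertible_matrix_inv[of A] by (auto simp: GL_def)
  show "\<one>\<^bsub>GL\<^esub> \<in> carrier (GL :: (complex^'n^'n) monoid)"
    unfolding GL_def by (auto simp: invertible_def intro: exI[of _ "mat 1"])
qed (auto simp: GL_def invertible_mult matrix_mul_assoc)

text \<open>
  Turns the subgroup conditions of the algebraic record into closure conditions in terms of
  \<open>(**)\<close> and \<open>matrix_inv\<close>, in which all later computations are carried out.
\<close>

lemma subgroup_GL_iff:
  fixes H :: "(complex^'n^'n) set"
  shows "subgroup H GL \<longleftrightarrow> mat 1 \<in> H \<and> (\<forall>A\<in>H. invertible A) \<and> (\<forall>A\<in>H. \<forall>B\<in>H. A ** B \<in> H) \<and>
     (\<forall>A\<in>H. matrix_inv A \<in> H)"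
proof -
  interpret group "GL :: (complex^'n^'n) monoid" by (rule group_GL)
  have inv: "inv\<^bsub>GL\<^esub> A = matrix_inv A" if "invertible A" for A :: "complex^'n^'n"
    using that by (intro inv_equality) (auto simp: GL_def matrix_inv invertible_matrix_inv)
  show ?thesis
  proof
    assume "subgroup H GL"
    then show "mat 1 \<in> H \<and> (\<forall>A\<in>H. invertible A) \<and> (\<forall>A\<in>H. \<forall>B\<in>H. A ** B \<in> H) \<and>
        (\<forall>A\<in>H. matrix_inv A \<in> H)"
      using inv unfolding subgroup_def by (auto simp: GL_def) (metis subsetD mem_Collect_eq)+
  next
    assume "mat 1 \<in> H \<and> (\<forall>A\<in>H. invertible A) \<and> (\<forall>A\<in>H. \<forall>B\<in>H. A ** B \<in> H) \<and>
        (\<forall>A\<in>H. matrix_inv A \<in> H)"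
    then show "subgroup H GL"
      using inv unfolding subgroup_def by (auto simp: GL_def)
  qed
qed

text \<open>
  The point is that the inverse of an invertible real matrix is real: its entrywise complex
  conjugate is an inverse of the same matrix.
\<close>

lemma subgroup_GL_rational_points:
  assumes H: "subgroup \<G> GL" and F: "F = UNIV \<or> F = \<real>"
  shows "subgroup (rational_points F \<G>) (GL :: (complex^'n^'n) monoid)"
proof -
  have mult: "A ** B \<in> rational_points F \<G>"
    if "A \<in> rational_points F \<G>" "B \<in> rational_points F \<G>" for A B
    using that F H unfolding rational_points_def subgroup_GL_iff
    by (auto simp: matrix_matrix_mult_def intro!: sum_in_Reals Reals_mult)
  have real_inv: "matrix_inv A $ i $ j \<in> \<real>"
    if A: "invertible A" "\<forall>i j. A $ i $ j \<in> \<real>" for A :: "complex^'n^'n" and i j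
  proof -
    let ?B = "\<chi> i j. cnj (matrix_inv A $ i $ j)"
    have "(A ** ?B) $ i $ j = cnj ((A ** matrix_inv A) $ i $ j)" for i j
      using A(2) by (simp add: matrix_matrix_mult_def Reals_cnj_iff)
    then have "A ** ?B = mat 1"
      using matrix_inv(1)[OF A(1)] by (simp add: vec_eq_iff mat_def)
    then have "matrix_inv A $ i $ j = cnj (matrix_inv A $ i $ j)"
      using matrix_inv_unique[of A ?B] by (metis vec_lambda_beta)
    then show ?thesis
      by (simp add: Reals_cnj_iff)
  qed
  have "matrix_inv A \<in> rational_points F \<G>" if "A \<in> rational_points F \<G>" for A
    using that F H real_inv[of A] unfolding rational_points_def subgroup_GL_iff by auto
  moreover have "mat 1 \<in> rational_points F \<G>"
    using F H unfolding rational_points_def subgroup_GL_iff by (auto simp: mat_def)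
  ultimately show ?thesis
    using mult H unfolding subgroup_GL_iff rational_points_def by auto
qed

section \<open>The adjoint action on Cartan subspaces and chambers\<close>

lemma matrix_inv_mult:
  fixes g h :: "complex^'n^'n"
  assumes "invertible g" "invertible h"
  shows "matrix_inv (g ** h) = matrix_inv h ** matrix_inv g"
  using assms by (intro matrix_inv_unique) (metis matrix_inv(1) matrix_mul_assoc matrix_mul_rid)

lemma matrix_inv_mat_1 [simp]: "matrix_inv (mat 1 :: complex^'n^'n) = mat 1"
  by (rule matrix_inv_unique) simp

lemma Ad_1 [simp]: "Ad (mat 1) X = X"
  by (simp add: Ad_def)

lemma Ad_mult: "invertible g \<Longrightarrow> invertible h \<Longrightarrow> Ad (g ** h) X = Ad g (Ad h X)"
  by (simp add: Ad_def matrix_inv_mult matrix_mul_assoc)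

lemma Ad_inverse:
  assumes "invertible g"
  shows "Ad (matrix_inv g) (Ad g X) = X" "Ad g (Ad (matrix_inv g) X) = X"
  using assms by (metis Ad_1 Ad_mult invertible_matrix_inv matrix_inv)+

lemma linear_Ad: "linear (Ad g)"
  by (auto intro!: linearI simp: Ad_def matrix_mult.add_left matrix_mult.add_right
      matrix_mult.scaleR_left matrix_mult.scaleR_right)

lemma Ad_matrix_mult: "invertible g \<Longrightarrow> Ad g (X ** Y) = Ad g X ** Ad g Y"
  unfolding Ad_def by (metis matrix_inv(2) matrix_mul_assoc matrix_mul_rid)

lemma bracket_Ad: "invertible g \<Longrightarrow> bracket (Ad g X) (Ad g Y) = Ad g (bracket X Y)"
  by (simp add: bracket_def Ad_matrix_mult linear_diff[OF linear_Ad])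

lemma trace_form_Ad: "invertible g \<Longrightarrow> trace_form (Ad g X) (Ad g Y) = trace_form X Y"
  unfolding trace_form_def
  by (simp flip: Ad_matrix_mult)
    (metis Ad_def matrix_inv(2) matrix_mul_assoc matrix_mul_rid trace_mul_sym)

lemma mexp_Ad:
  assumes "invertible g"
  shows "mexp (Ad g X) = Ad g (mexp X)"
proof -
  have pow: "mat_power (Ad g X) k = Ad g (mat_power X k)" for k
  proof (induction k)
    case 0
    then show ?case using assms by (simp add: Ad_def matrix_inv)
  next
    case (Suc k)
    then show ?case using assms by (simp add: Ad_matrix_mult)
  qed
  have "(\<lambda>k. (1 / fact k) *\<^sub>R mat_power X k) sums mexp X"
    unfolding mexp_def
    by (rule summable_sums[OF summable_norm_cancel[OF summable_norm_mexp_series]])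
  then have "(\<lambda>k. Ad g ((1 / fact k) *\<^sub>R mat_power X k)) sums Ad g (mexp X)"
    by (rule bounded_linear.sums[OF linear_Ad[unfolded linear_conv_bounded_linear]])
  then show ?thesis
    unfolding mexp_def by (simp add: pow linear_scale[OF linear_Ad] sums_iff)
qed

lemma mexp_0 [simp]: "mexp (0 :: complex^'n^'n) = mat 1"
proof -
  have "mat_power (0 :: complex^'n^'n) k = 0" if "k \<noteq> 0" for k
    using that by (cases k) (auto simp: matrix_mult.zero_left)
  then have "mexp (0 :: complex^'n^'n) = (\<Sum>k\<in>{0}. (1 / fact k) *\<^sub>R mat_power 0 k)"
    unfolding mexp_def by (intro suminf_finite) auto
  then show ?thesis by simp
qed

lemma mexp_mem: "X \<in> lie_algebra G \<Longrightarrow> mexp X \<in> G"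
  unfolding lie_algebra_def by (metis (mono_tags) mem_Collect_eq scaleR_one)

lemma Ad_lie_algebra:
  assumes "subgroup G GL" "g \<in> G" "X \<in> lie_algebra G"
  shows "Ad g X \<in> lie_algebra G"
proof -
  have "mexp (t *\<^sub>R Ad g X) = g ** mexp (t *\<^sub>R X) ** matrix_inv g" for t
    using assms by (metis Ad_def linear_Ad linear_scale mexp_Ad subgroup_GL_iff)
  then show ?thesis
    using assms unfolding lie_algebra_def subgroup_GL_iff by auto
qed

lemma cartan_decompositionD:
  assumes "cartan_decomposition g k p"
  shows "subspace p" "p \<subseteq> g"
    and "X \<in> g \<Longrightarrow> \<exists>Z\<in>k. \<exists>Y\<in>p. X = Z + Y"
    and "Z \<in> k \<Longrightarrow> Y \<in> p \<Longrightarrow> trace_form Z Y = 0"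
    and "Z \<in> k \<Longrightarrow> Z \<noteq> 0 \<Longrightarrow> trace_form Z Z < 0"
proof -
  show "subspace p"
    using assms unfolding cartan_decomposition_def by (elim conjE)
  show "trace_form Z Y = 0" if "Z \<in> k" "Y \<in> p"
    using assms that unfolding cartan_decomposition_def by (elim conjE) blast
  show "trace_form Z Z < 0" if "Z \<in> k" "Z \<noteq> 0"
    using assms that unfolding cartan_decomposition_def by (elim conjE) blast
  have g: "g = {X + Y | X Y. X \<in> k \<and> Y \<in> p}"
    using assms unfolding cartan_decomposition_def by (elim conjE)
  have "subspace k"
    using assms unfolding cartan_decomposition_def by (elim conjE)
  then have "0 \<in> k"
    by (rule subspace_0)
  show "X \<in> g \<Longrightarrow> \<exists>Z\<in>k. \<exists>Y\<in>p. X = Z + Y"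
    using g by blast
  show "p \<subseteq> g"
  proof
    fix Y assume "Y \<in> p"
    then have "0 + Y \<in> g" using \<open>0 \<in> k\<close> g by blast
    then show "Y \<in> g" by simp
  qed
qed

text \<open>
  The adjoint action of \<open>K\<close> preserves both Lie algebras and the trace form. Hence \<open>Ad k Y\<close> lies in
  the Lie algebra of \<open>G\<close> and is orthogonal to the Lie algebra of \<open>K\<close>. Its component \<open>Z\<close> in the
  latter is therefore orthogonal to itself, and vanishes since the form is definite there.
\<close>

lemma Ad_cartan_decomposition:
  assumes G: "subgroup G GL" and K: "subgroup K GL" "K \<subseteq> G"
    and dec: "cartan_decomposition (lie_algebra G) (lie_algebra K) p"
    and k: "k \<in> K" and Y: "Y \<in> p"
  shows "Ad k Y \<in> p"
proof -
  have inv: "invertible k" and k': "matrix_inv k \<in> K"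
    using K(1) k by (auto simp: subgroup_GL_iff)
  have "Y \<in> lie_algebra G"
    using cartan_decompositionD(2)[OF dec] Y by blast
  then have "Ad k Y \<in> lie_algebra G"
    using Ad_lie_algebra G K(2) k by blast
  then obtain Z Y' where Z: "Z \<in> lie_algebra K" and Y': "Y' \<in> p" and eq: "Ad k Y = Z + Y'"
    using cartan_decompositionD(3)[OF dec] by blast
  have orth: "trace_form Z X = 0" if "Z \<in> lie_algebra K" "X \<in> p" for Z X
    using cartan_decompositionD(4)[OF dec] that by blast
  have "trace_form Z Z + trace_form Z Y' = trace_form Z (Ad k Y)"
    by (simp add: eq trace_form_def matrix_mult.add_right trace_add)
  also have "\<dots> = trace_form (Ad (matrix_inv k) Z) Y"
    using trace_form_Ad[OF inv, of "Ad (matrix_inv k) Z" Y] by (simp add: Ad_inverse inv)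
  also have "\<dots> = 0"
    using Ad_lie_algebra[OF K(1) k' Z] Y by (rule orth)
  finally have "trace_form Z Z = 0"
    using orth[OF Z Y'] by simp
  then have "Z = 0"
    using cartan_decompositionD(5)[OF dec Z] by force
  then show ?thesis using eq Y' by simp
qed

lemma abelian_subspace_Ad:
  assumes "invertible g" "\<And>X. X \<in> p \<Longrightarrow> Ad g X \<in> p" "abelian_subspace p a"
  shows "abelian_subspace p (Ad g ` a)"
  using assms unfolding abelian_subspace_def
  by (auto simp: bracket_Ad linear_0[OF linear_Ad] intro: linear_subspace_image[OF linear_Ad])

text \<open>
  For maximality, an abelian subspace containing \<open>Ad g ` a\<close> is moved back by \<open>matrix_inv g\<close>.
\<close>

lemma cartan_subspace_Ad:
  assumes g: "invertible g" "\<And>X. X \<in> p \<Longrightarrow> Ad g X \<in> p" "\<And>X. X \<in> p \<Longrightarrow> Ad (matrix_inv g) X \<in> p"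
    and a: "cartan_subspace p a"
  shows "cartan_subspace p (Ad g ` a)"
  unfolding cartan_subspace_def
proof (intro conjI allI impI)
  show "abelian_subspace p (Ad g ` a)"
    using a g by (auto simp: cartan_subspace_def intro: abelian_subspace_Ad)
next
  fix b assume b: "abelian_subspace p b \<and> Ad g ` a \<subseteq> b"
  have "a \<subseteq> Ad (matrix_inv g) ` b"
  proof
    fix X assume "X \<in> a"
    then have "Ad g X \<in> b" using b by blast
    then show "X \<in> Ad (matrix_inv g) ` b"
      using Ad_inverse(1)[OF g(1), of X] by (metis imageI)
  qed
  moreover have "abelian_subspace p (Ad (matrix_inv g) ` b)"
    using b g by (intro abelian_subspace_Ad invertible_matrix_inv) auto
  ultimately have "Ad (matrix_inv g) ` b = a"
    using a unfolding cartan_subspace_def by blast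
  then have "Ad g ` a = Ad g ` Ad (matrix_inv g) ` b" by simp
  then show "b = Ad g ` a"
    by (simp add: image_image Ad_inverse g(1))
qed

lemma Ad_orbit_eq_iff:
  assumes "subgroup K GL"
  shows "Ad_orbit K A = Ad_orbit K \<alpha> \<longleftrightarrow> A \<in> Ad_orbit K \<alpha>"
proof
  assume "Ad_orbit K A = Ad_orbit K \<alpha>"
  moreover have "Ad (mat 1) A \<in> Ad_orbit K A"
    using assms unfolding Ad_orbit_def subgroup_GL_iff by blast
  ultimately show "A \<in> Ad_orbit K \<alpha>" by simp
next
  have sub: "Ad_orbit K (Ad k \<alpha>) \<subseteq> Ad_orbit K \<alpha>" if "k \<in> K" for k \<alpha>
    using assms that unfolding Ad_orbit_def subgroup_GL_iff
    by (auto simp flip: Ad_mult)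
  assume "A \<in> Ad_orbit K \<alpha>"
  then obtain k where k: "k \<in> K" "A = Ad k \<alpha>" unfolding Ad_orbit_def by blast
  then have "\<alpha> = Ad (matrix_inv k) A" "matrix_inv k \<in> K"
    using assms by (auto simp: Ad_inverse subgroup_GL_iff)
  then show "Ad_orbit K A = Ad_orbit K \<alpha>"
    using sub k by (metis subset_antisym)
qed

text \<open>
  The identity belongs to the Weyl group, so \<open>u\<close> itself lies in the Weyl orbit of \<open>\<alpha>\<close>. The
  conclusion speaks of \<open>K\<close> instead of the Weyl group because \<open>\<Delta>\<close>-lengths will be compared with
  orbits and double cosets of \<open>K\<close>.
\<close>

lemma weyl_orbit_eq_imp_Ad:
  assumes "subgroup K GL" "(\<lambda>w. w u) ` weyl_group K a = (\<lambda>w. w \<alpha>) ` weyl_group K a"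
    "u \<in> a" "\<alpha> \<in> a"
  shows "\<exists>k\<in>K. u = Ad k \<alpha>"
proof -
  have "restrict (Ad (mat 1)) a \<in> weyl_group K a"
    using assms(1) unfolding weyl_group_def subgroup_GL_iff by force
  then have "restrict (Ad (mat 1)) a u \<in> (\<lambda>w. w \<alpha>) ` weyl_group K a"
    using assms(2) by blast
  then show ?thesis
    using assms(3,4) unfolding weyl_group_def by auto
qed

text \<open>
  The closure of the chamber is taken in the space of all matrices; it stays in \<open>a\<close> because linear
  subspaces are closed in finite dimension.
\<close>

lemma closed_weyl_chamber_subset:
  assumes "subspace a" "closed_weyl_chamber g a \<Delta>"
  shows "\<Delta> \<subseteq> a"
proof -
  obtain C where C: "C \<in> components {H \<in> a. \<forall>\<rho> \<in> restricted_roots g a. \<rho> H \<noteq> 0}"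
    "\<Delta> = closure C"
    using assms(2) unfolding closed_weyl_chamber_def by blast
  then have "C \<subseteq> a" using in_components_subset by fastforce
  then show ?thesis
    using C(2) closed_subspace[OF assms(1)] by (simp add: closure_minimal)
qed

section \<open>Triangles in the infinitesimal symmetric space\<close>

text \<open>
  In both geometries it suffices to find a chart that takes \<open>0\<close> to the starting point and \<open>\<alpha>\<close>
  itself, rather than another vector of its Weyl orbit, to the end point.
\<close>

lemma delta_lengthsI:
  assumes "\<alpha> \<in> \<Delta>" "\<phi> ` a \<in> apts" "\<phi> \<in> charts (\<phi> ` a)" "0 \<in> a" "\<alpha> \<in> a"
    and "\<phi> 0 = x" "\<phi> \<alpha> = y"
  shows "\<alpha> \<in> delta_lengths W a \<Delta> apts charts x y"
proof -
  have "x \<in> \<phi> ` a" "y \<in> \<phi> ` a"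
    using assms by (metis imageI)+
  moreover have "(\<lambda>w. w (\<alpha> - 0)) ` W = (\<lambda>w. w \<alpha>) ` W"
    by simp
  ultimately show ?thesis
    unfolding delta_lengths_def using assms
    by (intro CollectI conjI bexI[of _ "\<phi> ` a"] bexI[of _ \<phi>] bexI[of _ 0] bexI[of _ \<alpha>])
qed

text \<open>
  The \<open>\<Delta>\<close>-length forgets the apartment. Reading \<open>y - x\<close> in a chart changes it by an element of
  \<open>Ad K\<close>, and so does the Weyl group. Conversely, if \<open>y - x = Ad k \<alpha>\<close>, then \<open>x + Ad k a\<close> is an
  apartment through \<open>x\<close> and \<open>y\<close> in which the segment corresponds to the vector from \<open>0\<close> to \<open>\<alpha>\<close>.
\<close>

lemma delta_lengths_p_iff:
  assumes K: "subgroup K GL" and Ad: "\<And>k X. k \<in> K \<Longrightarrow> X \<in> p \<Longrightarrow> Ad k X \<in> p"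
    and a: "cartan_subspace p a" and \<Delta>: "\<Delta> \<subseteq> a" and x: "x \<in> p"
  shows "\<alpha> \<in> delta_lengths (weyl_group K a) a \<Delta> (apartments_p p) (charts_p K p a) x y \<longleftrightarrow>
    \<alpha> \<in> \<Delta> \<and> y - x \<in> Ad_orbit K \<alpha>"
proof
  have sub: "subspace a" using a by (simp add: cartan_subspace_def abelian_subspace_def)
  {
    assume "\<alpha> \<in> delta_lengths (weyl_group K a) a \<Delta> (apartments_p p) (charts_p K p a) x y"
    then obtain x0 k u v where \<alpha>: "\<alpha> \<in> \<Delta>" and k: "k \<in> K" and uv: "u \<in> a" "v \<in> a"
      and xy: "x = x0 + Ad k u" "y = x0 + Ad k v"
      and W: "(\<lambda>w. w (v - u)) ` weyl_group K a = (\<lambda>w. w \<alpha>) ` weyl_group K a"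
      unfolding delta_lengths_def charts_p_def by auto
    have "v - u \<in> a" using sub uv by (simp add: subspace_diff)
    then obtain l where l: "l \<in> K" "v - u = Ad l \<alpha>"
      using weyl_orbit_eq_imp_Ad[OF K W] \<alpha> \<Delta> by blast
    have "y - x = Ad k (v - u)" by (simp add: xy linear_diff[OF linear_Ad])
    also have "\<dots> = Ad (k ** l) \<alpha>"
      using K k l by (simp add: Ad_mult subgroup_GL_iff)
    finally show "\<alpha> \<in> \<Delta> \<and> y - x \<in> Ad_orbit K \<alpha>"
      using \<alpha> K k l unfolding Ad_orbit_def subgroup_GL_iff by blast
  next
    assume *: "\<alpha> \<in> \<Delta> \<and> y - x \<in> Ad_orbit K \<alpha>"
    then obtain k where k: "k \<in> K" "y = x + Ad k \<alpha>"
      unfolding Ad_orbit_def by (auto simp: algebra_simps)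
    let ?\<phi> = "\<lambda>u\<in>a. x + Ad k u"
    have im: "?\<phi> ` a = (\<lambda>v. x + v) ` Ad k ` a"
      by (simp add: image_image)
    have "cartan_subspace p (Ad k ` a)"
      using K k Ad a by (intro cartan_subspace_Ad) (auto simp: subgroup_GL_iff)
    then have apt: "?\<phi> ` a \<in> apartments_p p"
      using x unfolding apartments_p_def im by blast
    have chart: "?\<phi> \<in> charts_p K p a (?\<phi> ` a)"
      using x k unfolding charts_p_def by blast
    have mem: "0 \<in> a" "\<alpha> \<in> a"
      using sub * \<Delta> by (auto simp: subspace_0)
    then have "?\<phi> 0 = x" "?\<phi> \<alpha> = y"
      using k by (simp_all add: linear_0[OF linear_Ad])
    then show "\<alpha> \<in> delta_lengths (weyl_group K a) a \<Delta> (apartments_p p) (charts_p K p a) x y"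
      by (intro delta_lengthsI[where \<phi> = ?\<phi>] conjunct1[OF *] apt chart mem)
  }
qed

text \<open>
  The sides of a triangle, regarded as vectors, sum to zero; and three vectors \<open>A\<close>, \<open>B\<close>, \<open>C\<close> with
  sum zero are the sides of the triangle with vertices \<open>0\<close>, \<open>A\<close>, \<open>A + B\<close>.
\<close>

theorem Sol_Q1_eq_D3_p:
  assumes K: "subgroup K GL" and p: "subspace p" and Ad: "\<And>k X. k \<in> K \<Longrightarrow> X \<in> p \<Longrightarrow> Ad k X \<in> p"
    and a: "cartan_subspace p a" and \<Delta>: "\<Delta> \<subseteq> a"
  shows "Sol_Q1 K p \<Delta> = D3_p K p a \<Delta>"
proof -
  let ?S = "\<lambda>\<alpha> \<beta> \<gamma>. \<exists>A\<in>p. \<exists>B\<in>p. \<exists>C\<in>p.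
    A \<in> Ad_orbit K \<alpha> \<and> B \<in> Ad_orbit K \<beta> \<and> C \<in> Ad_orbit K \<gamma> \<and> A + B + C = 0"
  let ?D = "\<lambda>\<alpha> \<beta> \<gamma>. \<exists>x1\<in>p. \<exists>x2\<in>p. \<exists>x3\<in>p.
    x2 - x1 \<in> Ad_orbit K \<alpha> \<and> x3 - x2 \<in> Ad_orbit K \<beta> \<and> x1 - x3 \<in> Ad_orbit K \<gamma>"
  have "?S \<alpha> \<beta> \<gamma> \<longleftrightarrow> ?D \<alpha> \<beta> \<gamma>" for \<alpha> \<beta> \<gamma>
  proof
    assume "?S \<alpha> \<beta> \<gamma>"
    then obtain A B C where ABC: "A \<in> p" "B \<in> p" "A \<in> Ad_orbit K \<alpha>" "B \<in> Ad_orbit K \<beta>"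
      "C \<in> Ad_orbit K \<gamma>" "A + B + C = 0" by blast
    then have "0 - (A + B) = C" by (metis add_diff_cancel_left')
    then show "?D \<alpha> \<beta> \<gamma>"
      using ABC p
      by (intro bexI[of _ 0] bexI[of _ A] bexI[of _ "A + B"]) (auto simp: subspace_0 subspace_add)
  next
    assume "?D \<alpha> \<beta> \<gamma>"
    then obtain x1 x2 x3 where "x1 \<in> p" "x2 \<in> p" "x3 \<in> p"
      "x2 - x1 \<in> Ad_orbit K \<alpha>" "x3 - x2 \<in> Ad_orbit K \<beta>" "x1 - x3 \<in> Ad_orbit K \<gamma>"
      by blast
    with p show "?S \<alpha> \<beta> \<gamma>"
      by (intro bexI[of _ "x2 - x1"] bexI[of _ "x3 - x2"] bexI[of _ "x1 - x3"])
        (auto simp: subspace_diff)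
  qed
  then show ?thesis
    unfolding Sol_Q1_def D3_p_def D3_def
    by (simp add: Ad_orbit_eq_iff[OF K] delta_lengths_p_iff[OF K Ad a \<Delta>] cong: bex_cong)
      blast
qed

section \<open>Triangles in the symmetric space\<close>

lemma l_coset_GL: "g <#\<^bsub>GL\<^esub> H = (\<lambda>h. g ** h) ` H"
  by (auto simp: l_coset_def GL_def)

lemma l_coset_GL_assoc: "g <#\<^bsub>GL\<^esub> (h <#\<^bsub>GL\<^esub> H) = (g ** h) <#\<^bsub>GL\<^esub> H"
  by (simp add: l_coset_GL image_image matrix_mul_assoc)

lemma double_coset_eq: "double_coset K \<sigma> = {k ** mexp \<sigma> ** l | k l. k \<in> K \<and> l \<in> K}"
  by (auto simp: double_coset_def set_mult_def r_coset_def GL_def)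

lemma l_coset_GL_eq_iff:
  assumes "subgroup K GL"
  shows "g <#\<^bsub>GL\<^esub> K = h <#\<^bsub>GL\<^esub> K \<longleftrightarrow> (\<exists>k\<in>K. h = g ** k)"
proof
  assume "g <#\<^bsub>GL\<^esub> K = h <#\<^bsub>GL\<^esub> K"
  moreover have "h ** mat 1 \<in> h <#\<^bsub>GL\<^esub> K"
    using assms unfolding l_coset_GL subgroup_GL_iff by blast
  ultimately show "\<exists>k\<in>K. h = g ** k" by (auto simp: l_coset_GL)
next
  assume "\<exists>k\<in>K. h = g ** k"
  then obtain k where k: "k \<in> K" "h = g ** k" by blast
  have "l = k ** (matrix_inv k ** l)" if "l \<in> K" for l
    using assms k(1) by (simp add: matrix_mul_assoc matrix_inv subgroup_GL_iff)
  then have "k <#\<^bsub>GL\<^esub> K = K"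
    using assms k(1) unfolding l_coset_GL subgroup_GL_iff by (auto intro!: image_eqI)
  then show "g <#\<^bsub>GL\<^esub> K = h <#\<^bsub>GL\<^esub> K"
    by (simp add: k(2) flip: l_coset_GL_assoc)
qed

text \<open>
  The analogue of \<open>delta_lengths_p_iff\<close>. In a chart \<open>u \<mapsto> g exp(u) K\<close> the points with coordinates
  \<open>u\<close> and \<open>v\<close> are \<open>g exp(u) K\<close> and \<open>g exp(u) exp(v - u) K\<close>, since \<open>a\<close> is abelian; if
  \<open>v - u = Ad k \<alpha>\<close>, then they are \<open>h K\<close> and \<open>h exp(\<alpha>) K\<close> with \<open>h = g exp(u) k\<close>.
  Conversely, the chart \<open>u \<mapsto> h exp(u) K\<close> takes \<open>0\<close> and \<open>\<alpha>\<close> to the two points.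
\<close>

lemma delta_lengths_X_iff:
  assumes G: "subgroup G GL" and K: "subgroup K GL" "K \<subseteq> G"
    and a: "abelian_subspace p a" "a \<subseteq> lie_algebra G" and \<Delta>: "\<Delta> \<subseteq> a"
  shows "\<alpha> \<in> delta_lengths (weyl_group K a) a \<Delta> (apartments_X G K a) (charts_X G K a) x y \<longleftrightarrow>
    \<alpha> \<in> \<Delta> \<and> (\<exists>h\<in>G. x = h <#\<^bsub>GL\<^esub> K \<and> y = (h ** mexp \<alpha>) <#\<^bsub>GL\<^esub> K)"
proof
  have sub: "subspace a" using a by (simp add: abelian_subspace_def)
  {
    assume "\<alpha> \<in> delta_lengths (weyl_group K a) a \<Delta> (apartments_X G K a) (charts_X G K a) x y"
    then obtain g u v where \<alpha>: "\<alpha> \<in> \<Delta>" and g: "g \<in> G" and uv: "u \<in> a" "v \<in> a"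
      and x: "x = (g ** mexp u) <#\<^bsub>GL\<^esub> K" and y: "y = (g ** mexp v) <#\<^bsub>GL\<^esub> K"
      and W: "(\<lambda>w. w (v - u)) ` weyl_group K a = (\<lambda>w. w \<alpha>) ` weyl_group K a"
      unfolding delta_lengths_def charts_X_def by (auto simp: l_coset_GL_assoc)
    have vu: "v - u \<in> a" using sub uv by (simp add: subspace_diff)
    then obtain k where k: "k \<in> K" "v - u = Ad k \<alpha>"
      using weyl_orbit_eq_imp_Ad[OF K(1) W] \<alpha> \<Delta> by blast
    have kinv: "invertible k" "matrix_inv k \<in> K" using K k by (auto simp: subgroup_GL_iff)
    \<comment> \<open>The representative of \<open>x\<close> that absorbs the rotation of \<open>v - u\<close> into the chamber.\<close>
    let ?h = "g ** mexp u ** k"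
    have "u ** (v - u) = (v - u) ** u"
      using a(1) uv(1) vu unfolding abelian_subspace_def bracket_def by auto
    then have "mexp v = mexp u ** mexp (v - u)"
      using mexp_add_commuting[of u "v - u"] by simp
    also have "mexp (v - u) = k ** mexp \<alpha> ** matrix_inv k"
      using mexp_Ad[OF kinv(1), of \<alpha>] unfolding k(2) by (simp add: Ad_def)
    finally have "g ** mexp v = ?h ** mexp \<alpha> ** matrix_inv k"
      by (simp add: matrix_mul_assoc)
    then have "y = (?h ** mexp \<alpha>) <#\<^bsub>GL\<^esub> K"
      using y kinv(2) l_coset_GL_eq_iff[OF K(1), of "?h ** mexp \<alpha>" "g ** mexp v"] by blast
    moreover have "x = ?h <#\<^bsub>GL\<^esub> K"
      using x k(1) l_coset_GL_eq_iff[OF K(1), of "g ** mexp u" ?h] by blast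
    moreover have "?h \<in> G"
      using G K g k uv(1) a(2) mexp_mem unfolding subgroup_GL_iff by blast
    ultimately show "\<alpha> \<in> \<Delta> \<and> (\<exists>h\<in>G. x = h <#\<^bsub>GL\<^esub> K \<and> y = (h ** mexp \<alpha>) <#\<^bsub>GL\<^esub> K)"
      using \<alpha> by blast
  next
    assume *: "\<alpha> \<in> \<Delta> \<and> (\<exists>h\<in>G. x = h <#\<^bsub>GL\<^esub> K \<and> y = (h ** mexp \<alpha>) <#\<^bsub>GL\<^esub> K)"
    then obtain h where h: "h \<in> G" "x = h <#\<^bsub>GL\<^esub> K" "y = (h ** mexp \<alpha>) <#\<^bsub>GL\<^esub> K" by blast
    let ?\<phi> = "\<lambda>u\<in>a. h <#\<^bsub>GL\<^esub> (mexp u <#\<^bsub>GL\<^esub> K)"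
    have apt: "?\<phi> ` a \<in> apartments_X G K a"
      using h(1) unfolding apartments_X_def by (auto simp: image_restrict_eq)
    have chart: "?\<phi> \<in> charts_X G K a (?\<phi> ` a)"
      using h(1) unfolding charts_X_def by blast
    have mem: "0 \<in> a" "\<alpha> \<in> a"
      using sub * \<Delta> by (auto simp: subspace_0)
    then have "?\<phi> 0 = x" "?\<phi> \<alpha> = y"
      using h by (simp_all add: l_coset_GL_assoc)
    then show "\<alpha> \<in> delta_lengths (weyl_group K a) a \<Delta> (apartments_X G K a) (charts_X G K a) x y"
      by (intro delta_lengthsI[where \<phi> = ?\<phi>] conjunct1[OF *] apt chart mem)
  }
qed

text \<open>
  Together with \<open>delta_lengths_X_iff\<close> this says that the segment from \<open>g K\<close> to \<open>g A K\<close> has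
  \<open>\<Delta>\<close>-length \<open>\<alpha>\<close> exactly if \<open>A\<close> lies in the double coset of \<open>exp(\<alpha>)\<close>: the two factors from \<open>K\<close>
  are the freedom in choosing representatives \<open>h\<close> of the first and \<open>h exp(\<alpha>)\<close> of the second point.
\<close>

lemma double_coset_iff:
  assumes G: "subgroup G GL" and K: "subgroup K GL" "K \<subseteq> G"
    and g: "g \<in> G" and A: "A \<in> G"
  shows "A \<in> double_coset K \<alpha> \<longleftrightarrow> (\<exists>h\<in>G. g <#\<^bsub>GL\<^esub> K = h <#\<^bsub>GL\<^esub> K \<and>
    (g ** A) <#\<^bsub>GL\<^esub> K = (h ** mexp \<alpha>) <#\<^bsub>GL\<^esub> K)"
proof
  assume "A \<in> double_coset K \<alpha>"
  then obtain k l where kl: "k \<in> K" "l \<in> K" "A = k ** mexp \<alpha> ** l"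
    by (auto simp: double_coset_eq)
  have "(g ** k ** mexp \<alpha>) <#\<^bsub>GL\<^esub> K = (g ** A) <#\<^bsub>GL\<^esub> K"
    using kl l_coset_GL_eq_iff[OF K(1)] by (auto simp: matrix_mul_assoc)
  moreover have "g <#\<^bsub>GL\<^esub> K = (g ** k) <#\<^bsub>GL\<^esub> K"
    using kl(1) l_coset_GL_eq_iff[OF K(1)] by blast
  moreover have "g ** k \<in> G"
    using G K(2) g kl(1) by (auto simp: subgroup_GL_iff)
  ultimately show "\<exists>h\<in>G. g <#\<^bsub>GL\<^esub> K = h <#\<^bsub>GL\<^esub> K \<and>
      (g ** A) <#\<^bsub>GL\<^esub> K = (h ** mexp \<alpha>) <#\<^bsub>GL\<^esub> K"
    by auto
next
  assume "\<exists>h\<in>G. g <#\<^bsub>GL\<^esub> K = h <#\<^bsub>GL\<^esub> K \<and> (g ** A) <#\<^bsub>GL\<^esub> K = (h ** mexp \<alpha>) <#\<^bsub>GL\<^esub> K"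
  then obtain k l where kl: "k \<in> K" "l \<in> K" and eq: "g ** A = g ** k ** mexp \<alpha> ** l"
    using l_coset_GL_eq_iff[OF K(1)] by metis
  have "invertible g" using G g by (simp add: subgroup_GL_iff)
  then have "A = matrix_inv g ** (g ** A)" by (simp add: matrix_mul_assoc matrix_inv)
  also have "\<dots> = k ** mexp \<alpha> ** l"
    using \<open>invertible g\<close> by (simp add: eq matrix_mul_assoc matrix_inv)
  finally show "A \<in> double_coset K \<alpha>"
    using kl by (auto simp: double_coset_eq)
qed

text \<open>
  The multiplicative version of \<open>Sol_Q1_eq_D3_p\<close>. A solution of \<open>A B C = 1\<close> gives the triangle with
  vertices \<open>K\<close>, \<open>A K\<close>, \<open>A B K\<close>, and a triangle with vertices \<open>g1 K\<close>, \<open>g2 K\<close>, \<open>g3 K\<close> gives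
  the quotients of consecutive representatives, whose product around the triangle is \<open>1\<close>.
\<close>

theorem Sol_Q2_eq_D3_X:
  assumes G: "subgroup G GL" and K: "subgroup K GL" "K \<subseteq> G"
    and a: "abelian_subspace p a" "a \<subseteq> lie_algebra G" and \<Delta>: "\<Delta> \<subseteq> a"
  shows "Sol_Q2 G K \<Delta> = D3_X G K a \<Delta>"
proof -
  define R where "R \<alpha> x y \<longleftrightarrow> (\<exists>h\<in>G. x = h <#\<^bsub>GL\<^esub> K \<and> y = (h ** mexp \<alpha>) <#\<^bsub>GL\<^esub> K)"
    for \<alpha> x y
  let ?S = "\<lambda>\<alpha> \<beta> \<gamma>. \<exists>A\<in>G. \<exists>B\<in>G. \<exists>C\<in>G. A \<in> double_coset K \<alpha> \<and> B \<in> double_coset K \<beta> \<and>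
    C \<in> double_coset K \<gamma> \<and> A ** B ** C = mat 1"
  let ?D = "\<lambda>\<alpha> \<beta> \<gamma>. \<exists>x1\<in>symmetric_space G K. \<exists>x2\<in>symmetric_space G K.
    \<exists>x3\<in>symmetric_space G K. R \<alpha> x1 x2 \<and> R \<beta> x2 x3 \<and> R \<gamma> x3 x1"
  have one: "mat 1 \<in> G" and mult: "\<And>g h. g \<in> G \<Longrightarrow> h \<in> G \<Longrightarrow> g ** h \<in> G"
    and inv: "\<And>g. g \<in> G \<Longrightarrow> matrix_inv g \<in> G" and invertible: "\<And>g. g \<in> G \<Longrightarrow> invertible g"
    using G by (auto simp: subgroup_GL_iff)
  have R_iff: "R \<alpha> (g <#\<^bsub>GL\<^esub> K) ((g ** A) <#\<^bsub>GL\<^esub> K) \<longleftrightarrow> A \<in> double_coset K \<alpha>"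
    if "g \<in> G" "A \<in> G" for g A \<alpha>
    using double_coset_iff[OF G K that] by (simp add: R_def)
  have "?S \<alpha> \<beta> \<gamma> \<longleftrightarrow> ?D \<alpha> \<beta> \<gamma>" for \<alpha> \<beta> \<gamma>
  proof
    assume "?S \<alpha> \<beta> \<gamma>"
    then obtain A B C where ABC: "A \<in> G" "B \<in> G" "C \<in> G" "A \<in> double_coset K \<alpha>"
      "B \<in> double_coset K \<beta>" "C \<in> double_coset K \<gamma>" "A ** B ** C = mat 1" by blast
    then have "R \<alpha> (mat 1 <#\<^bsub>GL\<^esub> K) (A <#\<^bsub>GL\<^esub> K)" "R \<beta> (A <#\<^bsub>GL\<^esub> K) ((A ** B) <#\<^bsub>GL\<^esub> K)"
      "R \<gamma> ((A ** B) <#\<^bsub>GL\<^esub> K) (mat 1 <#\<^bsub>GL\<^esub> K)"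
      using R_iff[of "mat 1" A \<alpha>] R_iff[of A B \<beta>] R_iff[of "A ** B" C \<gamma>] one mult by simp_all
    then show "?D \<alpha> \<beta> \<gamma>"
      using ABC one mult unfolding symmetric_space_def by blast
  next
    assume "?D \<alpha> \<beta> \<gamma>"
    then obtain g1 g2 g3 where g: "g1 \<in> G" "g2 \<in> G" "g3 \<in> G"
      and R: "R \<alpha> (g1 <#\<^bsub>GL\<^esub> K) (g2 <#\<^bsub>GL\<^esub> K)" "R \<beta> (g2 <#\<^bsub>GL\<^esub> K) (g3 <#\<^bsub>GL\<^esub> K)"
        "R \<gamma> (g3 <#\<^bsub>GL\<^esub> K) (g1 <#\<^bsub>GL\<^esub> K)"
      unfolding symmetric_space_def by blast
    have quot: "matrix_inv g ** h \<in> double_coset K \<sigma>"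
      if "g \<in> G" "h \<in> G" "R \<sigma> (g <#\<^bsub>GL\<^esub> K) (h <#\<^bsub>GL\<^esub> K)" for g h \<sigma>
      using R_iff[of g "matrix_inv g ** h" \<sigma>] that mult inv invertible
      by (simp add: matrix_mul_assoc matrix_inv)
    have "matrix_inv g1 ** g2 ** (matrix_inv g2 ** g3) ** (matrix_inv g3 ** g1) =
        matrix_inv g1 ** (g2 ** matrix_inv g2) ** (g3 ** matrix_inv g3) ** g1"
      by (simp only: matrix_mul_assoc)
    also have "\<dots> = mat 1"
      using g invertible by (simp add: matrix_inv)
    finally show "?S \<alpha> \<beta> \<gamma>"
      using quot g R mult inv by blast
  qed
  then show ?thesis
    unfolding Sol_Q2_def D3_X_def D3_def delta_lengths_X_iff[OF G K a \<Delta>] R_def[symmetric]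
    by blast
qed

theorem theorem1p6:
  fixes \<G> G K p a \<Delta> :: "(complex^'n^'n) set" and F :: "complex set"
  assumes "connected_reductive_group \<G>"
    and "F = UNIV \<or> F = \<real>"
    and "G = rational_points F \<G>"
    and "maximal_compact_subgroup K G"
    and "cartan_decomposition (lie_algebra G) (lie_algebra K) p"
    and "cartan_subspace p a"
    and "closed_weyl_chamber (lie_algebra G) a \<Delta>"
  shows "Sol_Q1 K p \<Delta> = D3_p K p a \<Delta> \<and> Sol_Q2 G K \<Delta> = D3_X G K a \<Delta>"
proof
  have G: "subgroup G GL"
    using assms(1-3) subgroup_GL_rational_points by (auto simp: connected_reductive_group_def)
  have KG: "subgroup K (as_group G)"
    using assms(4) by (simp add: maximal_compact_subgroup_def)
  have K: "subgroup K GL" "K \<subseteq> G"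
    using group.incl_subgroup[OF group_GL G KG] subgroup.subset[OF KG] by auto
  have p: "subspace p"
    by (rule cartan_decompositionD(1)[OF assms(5)])
  have "p \<subseteq> lie_algebra G"
    by (rule cartan_decompositionD(2)[OF assms(5)])
  moreover have a: "abelian_subspace p a"
    using assms(6) by (simp add: cartan_subspace_def)
  ultimately have ag: "a \<subseteq> lie_algebra G" and sub: "subspace a"
    by (auto simp: abelian_subspace_def)
  have \<Delta>: "\<Delta> \<subseteq> a"
    using sub assms(7) by (rule closed_weyl_chamber_subset)
  show "Sol_Q1 K p \<Delta> = D3_p K p a \<Delta>"
    using Ad_cartan_decomposition[OF G K assms(5)]
    by (intro Sol_Q1_eq_D3_p[OF K(1) p _ assms(6) \<Delta>])
  show "Sol_Q2 G K \<Delta> = D3_X G K a \<Delta>"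
    by (rule Sol_Q2_eq_D3_X[OF G K a ag \<Delta>])
qed

end
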